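(* Let $G$ be a finite directed graph (without loops) with vertex set $V(G)$, and let $\mathcal K=2^{V(G)}$. The minimum broadcast rate $\mathrm{Ind}(G)$ of the index coding problem with side information graph $G$ is at most the optimum value of the following linear program in the variables $t$ and $(\rho_S)_{S\in\mathcal K}$: $$\begin{aligned}\min\quad & t\\ \text{s.t.}\quad & \sum_{S\in\mathcal K}\min\{|S\cap(\{v\}\cup N(v,\overline G))|,\;k_S+1\}\,\rho_S\le t, && v\in V(G),\\ & \sum_{S\in\mathcal K:\,v\in S}\rho_S\ge 1, && v\in V(G),\\ & \rho_S\in[0,1], && S\in\mathcal K.\end{aligned}$$
   Context: For a directed graph $H$ and vertex $v$, $N(v,H)\subseteq V(H)\setminus\{v\}$ is the set of out-neighbors of $v$. $\overline G$ is the directed complement of $G$: same vertex set, and for $u\ne v$, $(u,v)$ is an edge of $\overline G$ iff it is not an edge of $G$; thus $\{v\}\cup N(v,\overline G)=V(G)\setminus N(v,G)$. For nonempty $S\subseteq V(G)$, $S$ is a $k$-partial clique if in the subgraph of $G$ induced on $S$ every vertex has at least $|S|-k-1$ out-neighbors and some vertex has exactly $|S|-k-1$ out-neighbors; $k_S$ is the smallest $k$ such that $S$ is a $k$-partial clique, i.e. $k_S=\max_{v\in S}(|S|-1-|N(v,G)\cap S|)$. (For $S=\emptyset$ put $k_S=0$; its term is $0$.) Index coding: let $V(G)=\{v_1,\dots,v_n\}$; an edge $(v_i,v_j)$ means that client $i$ knows message $p_j$. For a finite alphabet $\Sigma$ with $|\Sigma|=q\ge2$, an index code for $G$ consists of a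 finite set $M$, an encoding function $f:\Sigma^n\to M$, and decoding functions $g_i:M\times\Sigma^{|N(v_i,G)|}\to\Sigma$ such that $g_i(f(p),(p_j)_{v_j\in N(v_i,G)})=p_i$ for all $p\in\Sigma^n$ and all $i$. $\mathrm{Ind}_q(G)$ is the minimum of $\log_q|M|$ over all such codes, and the broadcast rate is $\mathrm{Ind}(G)=\inf_{q\ge2}\mathrm{Ind}_q(G)$. *)

theory Defs
  imports "HOL-Analysis.Analysis" "Graph_Theory.Graph_Theory"
begin

definition out_nbrs :: "'a \<Rightarrow> ('a, 'b) pre_digraph \<Rightarrow> 'a set" where
  "out_nbrs v H = {w. v \<rightarrow>\<^bsub>H\<^esub> w}"

definition complement :: "('a, 'b) pre_digraph \<Rightarrow> ('a, 'a \<times> 'a) pre_digraph" where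
  "complement G =
     \<lparr> verts = verts G,
       arcs = {(u, v). u \<in> verts G \<and> v \<in> verts G \<and> u \<noteq> v \<and> \<not> u \<rightarrow>\<^bsub>G\<^esub> v},
       tail = fst, head = snd \<rparr>"

text \<open>The differences are taken in the integers, since \<open>|S| - k - 1\<close> may be negative.\<close>

definition partial_clique :: "('a, 'b) pre_digraph \<Rightarrow> nat \<Rightarrow> 'a set \<Rightarrow> bool" where
  "partial_clique G k S \<longleftrightarrow>
     S \<noteq> {} \<and> S \<subseteq> verts G \<and>
     (\<forall>v\<in>S. int (card (out_nbrs v (G \<restriction> S))) \<ge> int (card S) - int k - 1) \<and>
     (\<exists>v\<in>S. int (card (out_nbrs v (G \<restriction> S))) = int (card S) - int k - 1)"

definition clique_defect :: "('a, 'b) pre_digraph \<Rightarrow> 'a set \<Rightarrow> nat" where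
  "clique_defect G S = (if S = {} then 0 else (LEAST k. partial_clique G k S))"

text \<open>
  The alphabet is \<open>{..<q}\<close>; a message vector is an extensional function from the vertices
  to the alphabet, so that restricting it to the out-neighbours of \<open>v\<close> is exactly the side
  information of client \<open>v\<close>.  Only the cardinality of the codomain \<open>M\<close> matters,
  so it may be taken to be a finite set of natural numbers.
\<close>

definition index_code ::
  "('a, 'b) pre_digraph \<Rightarrow> nat \<Rightarrow> nat set \<Rightarrow> (('a \<Rightarrow> nat) \<Rightarrow> nat)
     \<Rightarrow> ('a \<Rightarrow> nat \<times> ('a \<Rightarrow> nat) \<Rightarrow> nat) \<Rightarrow> bool" where
  "index_code G q M f g \<longleftrightarrow>
     finite M \<and>
     f \<in> (verts G \<rightarrow>\<^sub>E {..<q}) \<rightarrow> M \<and>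
     (\<forall>v\<in>verts G. g v \<in> M \<times> (out_nbrs v G \<rightarrow>\<^sub>E {..<q}) \<rightarrow> {..<q}) \<and>
     (\<forall>p\<in>verts G \<rightarrow>\<^sub>E {..<q}. \<forall>v\<in>verts G. g v (f p, restrict p (out_nbrs v G)) = p v)"

definition Ind_alphabet :: "nat \<Rightarrow> ('a, 'b) pre_digraph \<Rightarrow> real" where
  "Ind_alphabet q G = Inf {log (real q) (real (card M)) | M f g. index_code G q M f g}"

definition Ind :: "('a, 'b) pre_digraph \<Rightarrow> real" where
  "Ind G = (INF q\<in>{2..}. Ind_alphabet q G)"

definition lp_feasible :: "('a, 'b) pre_digraph \<Rightarrow> real \<Rightarrow> ('a set \<Rightarrow> real) \<Rightarrow> bool" where
  "lp_feasible G t \<rho> \<longleftrightarrow>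
     (\<forall>v\<in>verts G.
        (\<Sum>S\<in>Pow (verts G).
           real (min (card (S \<inter> ({v} \<union> out_nbrs v (complement G)))) (clique_defect G S + 1)) * \<rho> S)
        \<le> t) \<and>
     (\<forall>v\<in>verts G. (\<Sum>S | S \<in> Pow (verts G) \<and> v \<in> S. \<rho> S) \<ge> 1) \<and>
     (\<forall>S\<in>Pow (verts G). \<rho> S \<in> {0..1})"

text \<open>
  For the graph without vertices \<open>t\<close> is unconstrained and the program has no optimum;
  otherwise the set below is nonempty and bounded below, as shown next.
\<close>

definition lp_optimum :: "('a, 'b) pre_digraph \<Rightarrow> real" where
  "lp_optimum G = Inf {t. \<exists>\<rho>. lp_feasible G t \<rho>}"

lemma lp_values_nonempty:
  assumes "digraph G"
  shows "{t. \<exists>\<rho>. lp_feasible G t \<rho>} \<noteq> {}"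
proof -
  interpret digraph G by fact
  let ?c = "\<lambda>v S. real (min (card (S \<inter> ({v} \<union> out_nbrs v (complement G)))) (clique_defect G S + 1))"
  let ?\<rho> = "\<lambda>_. 1 :: real"
  let ?t = "\<Sum>v\<in>verts G. \<Sum>S\<in>Pow (verts G). ?c v S * 1"
  have "(\<Sum>S\<in>Pow (verts G). ?c v S * 1) \<le> ?t" if "v \<in> verts G" for v
    by (rule member_le_sum[where f = "\<lambda>v. \<Sum>S\<in>Pow (verts G). ?c v S * 1"])
       (use that in \<open>auto intro!: sum_nonneg\<close>)
  moreover have "(\<Sum>S | S \<in> Pow (verts G) \<and> v \<in> S. ?\<rho> S) \<ge> 1" if "v \<in> verts G" for v
  proof -
    have "card {S \<in> Pow (verts G). v \<in> S} > 0"
      using that by (subst card_gt_0_iff) auto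
    then show ?thesis by simp
  qed
  ultimately have "lp_feasible G ?t ?\<rho>"
    unfolding lp_feasible_def by simp
  then show ?thesis by blast
qed

lemma lp_values_bdd_below:
  assumes "verts G \<noteq> {}"
  shows "bdd_below {t. \<exists>\<rho>. lp_feasible G t \<rho>}"
proof (rule bdd_belowI[of _ 0], clarify)
  fix t \<rho> assume *: "lp_feasible G t \<rho>"
  from assms obtain v where v: "v \<in> verts G" by blast
  have "0 \<le> (\<Sum>S\<in>Pow (verts G).
      real (min (card (S \<inter> ({v} \<union> out_nbrs v (complement G)))) (clique_defect G S + 1)) * \<rho> S)"
    using * unfolding lp_feasible_def by (intro sum_nonneg mult_nonneg_nonneg) auto
  also have "\<dots> \<le> t"
    using * v unfolding lp_feasible_def by blast
  finally show "0 \<le> t" .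
qed

lemma index_code_exists:
  assumes "digraph G" "q \<ge> 1"
  shows "\<exists>M f g. index_code G q M f g"
proof -
  interpret digraph G by fact
  let ?P = "verts G \<rightarrow>\<^sub>E {..<q}"
  have fin: "finite ?P" by (intro finite_PiE) auto
  then obtain f :: "('a \<Rightarrow> nat) \<Rightarrow> nat" where f: "inj_on f ?P"
    using finite_imp_inj_to_nat_seg by blast
  define g where "g = (\<lambda>v (m, x :: 'a \<Rightarrow> nat). inv_into ?P f m v)"
  have g: "g v (f p, x) = p v" if "p \<in> ?P" for v p x
    using inv_into_f_f[OF f that] by (simp add: g_def)
  have "g v y \<in> {..<q}" if v: "v \<in> verts G" and vy: "y \<in> (f ` ?P) \<times> (out_nbrs v G \<rightarrow>\<^sub>E {..<q})" for v y
  proof -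
    obtain p x where p: "p \<in> ?P" and y: "y = (f p, x)"
      using vy by blast
    show ?thesis unfolding y g[OF p] using PiE_mem[OF p v] .
  qed
  then have "index_code G q (f ` ?P) f g"
    unfolding index_code_def using fin g by (intro conjI ballI funcsetI) simp_all
  then show ?thesis by blast
qed

lemma index_code_rate_nonneg:
  assumes "index_code G q M f g" "q \<ge> 2"
  shows "0 \<le> log (real q) (real (card M))"
proof -
  have "(\<lambda>v\<in>verts G. 0) \<in> verts G \<rightarrow>\<^sub>E {..<q}"
    using assms(2) by auto
  moreover have "f \<in> (verts G \<rightarrow>\<^sub>E {..<q}) \<rightarrow> M" and "finite M"
    using assms(1) unfolding index_code_def by blast+
  ultimately have "M \<noteq> {}" "finite M"
    by (blast dest: funcset_mem)+
  then have "card M \<ge> 1"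
    by (simp add: Suc_leI card_gt_0_iff)
  then show ?thesis using assms(2) by simp
qed

lemma out_nbrs_complement:
  assumes "digraph G" "v \<in> verts G"
  shows "{v} \<union> out_nbrs v (complement G) = verts G - out_nbrs v G"
proof -
  interpret digraph G by fact
  show ?thesis using assms(2) no_loops
    by (auto simp: out_nbrs_def complement_def arcs_ends_conv)
qed

lemma out_nbrs_induce_subgraph:
  assumes "v \<in> S"
  shows "out_nbrs v (G \<restriction> S) = out_nbrs v G \<inter> S"
  using assms by (auto simp: out_nbrs_def induce_subgraph_def arcs_ends_conv)

lemma partial_clique_iff:
  assumes "digraph G" "S \<noteq> {}" "S \<subseteq> verts G"
  shows "partial_clique G k S \<longleftrightarrow> k = Max ((\<lambda>v. card S - 1 - card (out_nbrs v G \<inter> S)) ` S)"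
proof -
  interpret digraph G by fact
  have fin: "finite S" by (rule finite_subset[OF assms(3) finite_verts])
  have le: "card (out_nbrs v G \<inter> S) + 1 \<le> card S" if "v \<in> S" for v
  proof -
    have "out_nbrs v G \<inter> S \<subseteq> S - {v}"
      by (auto simp: out_nbrs_def dest: adj_not_same)
    then have "card (out_nbrs v G \<inter> S) \<le> card (S - {v})"
      using fin by (intro card_mono) auto
    then show ?thesis using that fin
      by (metis Suc_eq_plus1 add_le_mono1 card.remove)
  qed
  let ?d = "\<lambda>v. card S - 1 - card (out_nbrs v G \<inter> S)"
  have "partial_clique G k S \<longleftrightarrow> (\<forall>v\<in>S. ?d v \<le> k) \<and> (\<exists>v\<in>S. ?d v = k)"
  proof -
    have "int (card (out_nbrs v (G \<restriction> S))) \<ge> int (card S) - int k - 1 \<longleftrightarrow> ?d v \<le> k"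
      "int (card (out_nbrs v (G \<restriction> S))) = int (card S) - int k - 1 \<longleftrightarrow> ?d v = k" if "v \<in> S" for v
      using le[OF that] by (auto simp: out_nbrs_induce_subgraph[OF that])
    then show ?thesis using assms(2,3) unfolding partial_clique_def by auto
  qed
  also have "\<dots> \<longleftrightarrow> k = Max (?d ` S)"
    using fin assms(2) by (subst eq_Max_iff) auto
  finally show ?thesis .
qed

lemma clique_defect_eq_Max:
  assumes "digraph G" "S \<noteq> {}" "S \<subseteq> verts G"
  shows "clique_defect G S = Max ((\<lambda>v. card S - 1 - card (out_nbrs v G \<inter> S)) ` S)"
  using assms(2) unfolding clique_defect_def partial_clique_iff[OF assms] by (simp add: Least_equality)

end

theory Submission
  imports Defs "HOL-Real_Asymp.Real_Asymp"
begin

text \<open>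
  Fix a large \<open>N\<close> and let every \<open>S\<close> own \<open>m\<^sub>S = \<lceil>N \<rho>\<^sub>S\<rceil>\<close> slots. A message over the
  alphabet of size \<open>q\<^sup>N\<close> is encoded injectively by one base-\<open>q\<close> digit for each of the at least \<open>N\<close>
  slots of the sets containing its vertex. In each slot of \<open>S\<close> take \<open>k\<^sub>S + 1\<close> parities,
  the power sums \<open>\<Sum>w\<in>S. a\<^sub>w\<^sup>i x\<^sub>w\<close>; a client in \<open>S\<close> misses at most \<open>k\<^sub>S + 1\<close> of the digits, so the
  parities determine its own digit. The sums are taken over the integers, which costs only a constant
  factor in their range and needs no finite field.

  The parities are then compressed, not by a second linear code, but by a greedy colouring: parity
  vectors that client \<open>v\<close> may have to distinguish differ by an element of a set \<open>D\<^sub>v\<close> of size at most \<open>(K q)\<^sup>T\<close>,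
  where \<open>T\<close> is the largest left-hand side of the first constraint with \<open>m\<^sub>S\<close> in place of \<open>\<rho>\<^sub>S\<close>
  and \<open>K\<close> depends only on \<open>G\<close>. Hence \<open>n (K q)\<^sup>T + 1\<close> colours suffice. The rate of this code over the
  alphabet of size \<open>q\<^sup>N\<close> tends to \<open>T / N\<close> as \<open>q \<rightarrow> \<infinity>\<close>, and \<open>T / N \<le> t + O(1 / N)\<close>.
\<close>

section \<open>Vandermonde systems and greedy colouring\<close>

text \<open>Weight the equations by the coefficients of a polynomial of degree at most
  \<open>k\<close> that vanishes at every node of \<open>U\<close> except \<open>a u\<close>: only
  the term of \<open>u\<close> survives. No division occurs, so the integers will do.\<close>

lemma vandermonde_kernel_trivial:
  fixes a d :: "'a \<Rightarrow> 'r::idom"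
  assumes "finite U" "card U \<le> k + 1" "inj_on a U"
    and zero: "\<And>i. i \<le> k \<Longrightarrow> (\<Sum>w\<in>U. a w ^ i * d w) = 0"
    and "u \<in> U"
  shows "d u = 0"
proof -
  define P where "P = (\<Prod>w\<in>U - {u}. [:- a w, 1:])"
  have "degree P = card (U - {u})"
    unfolding P_def by (subst degree_prod_eq_sum_degree) auto
  then have deg: "degree P \<le> k"
    using assms(1,2,5) by simp
  have root: "poly P (a w) = 0" if "w \<in> U - {u}" for w
    using that assms(1) by (auto simp: P_def poly_prod intro!: prod_zero)
  have nz: "poly P (a u) \<noteq> 0"
    using assms(1,3,5) by (auto simp: P_def poly_prod inj_on_def)
  have "(\<Sum>w\<in>U. poly P (a w) * d w) =
      (\<Sum>w\<in>U. \<Sum>i\<le>degree P. coeff P i * (a w ^ i * d w))"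
    by (simp add: poly_altdef sum_distrib_right mult.assoc)
  also have "\<dots> = (\<Sum>i\<le>degree P. coeff P i * (\<Sum>w\<in>U. a w ^ i * d w))"
    by (subst sum.swap) (simp add: sum_distrib_left)
  also have "\<dots> = 0"
    using zero deg by (intro sum.neutral) auto
  finally have "(\<Sum>w\<in>U. poly P (a w) * d w) = 0" .
  moreover have "(\<Sum>w\<in>U. poly P (a w) * d w) = poly P (a u) * d u"
    using assms(1,5) root by (simp add: sum.remove[of U u])
  ultimately show ?thesis using nz by simp
qed

text \<open>Induction on \<open>Y\<close>: the neighbours of the new point use at most
  \<open>d\<close> of the \<open>d + 1\<close> colours.\<close>

lemma greedy_colouring:
  assumes "finite Y" and sym: "\<And>x y. R x y \<Longrightarrow> R y x"
    and "\<And>y. y \<in> Y \<Longrightarrow> card {z \<in> Y. z \<noteq> y \<and> R y z} \<le> d"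
  shows "\<exists>c. c \<in> Y \<rightarrow> {..d::nat} \<and> (\<forall>y\<in>Y. \<forall>z\<in>Y. z \<noteq> y \<and> R y z \<longrightarrow> c y \<noteq> c z)"
  using assms(1,3)
proof (induction Y rule: finite_induct)
  case empty
  then show ?case by simp
next
  case (insert x Y)
  have deg: "card {z \<in> Y. z \<noteq> y \<and> R y z} \<le> d" if "y \<in> Y" for y
  proof -
    have "card {z \<in> Y. z \<noteq> y \<and> R y z} \<le> card {z \<in> insert x Y. z \<noteq> y \<and> R y z}"
      using insert.hyps by (intro card_mono) auto
    also have "\<dots> \<le> d" using insert.prems that by blast
    finally show ?thesis .
  qed
  have "\<exists>c. c \<in> Y \<rightarrow> {..d} \<and> (\<forall>y\<in>Y. \<forall>z\<in>Y. z \<noteq> y \<and> R y z \<longrightarrow> c y \<noteq> c z)"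
    by (rule insert.IH) (rule deg)
  then obtain c where c: "c \<in> Y \<rightarrow> {..d}"
      "\<forall>y\<in>Y. \<forall>z\<in>Y. z \<noteq> y \<and> R y z \<longrightarrow> c y \<noteq> c z"
    by (elim exE conjE)
  let ?X = "{z \<in> insert x Y. z \<noteq> x \<and> R x z}"
  have "card (c ` ?X) \<le> card ?X"
    using insert.hyps by (intro card_image_le) auto
  also have "\<dots> \<le> d" using insert.prems by blast
  finally have "card (c ` ?X) < card {..d}" by simp
  moreover have "finite (c ` ?X)" using insert.hyps by auto
  ultimately have "\<not> {..d} \<subseteq> c ` ?X" by (meson card_mono leD)
  then obtain e where e: "e \<le> d" "e \<notin> c ` ?X" by blast
  let ?c = "c(x := e)"
  have "?c \<in> insert x Y \<rightarrow> {..d}" using c(1) e(1) by auto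
  moreover have "?c y \<noteq> ?c z" if "y \<in> insert x Y" "z \<in> insert x Y" "z \<noteq> y" "R y z" for y z
  proof -
    consider "y = x" "z \<in> Y" | "z = x" "y \<in> Y" | "y \<in> Y" "z \<in> Y"
      using \<open>y \<in> insert x Y\<close> \<open>z \<in> insert x Y\<close> \<open>z \<noteq> y\<close> by auto
    then show ?thesis
    proof cases
      case 1
      then have "c z \<in> c ` ?X" using that by blast
      then show ?thesis using 1 e(2) \<open>z \<noteq> y\<close> by auto
    next
      case 2
      then have "c y \<in> c ` ?X" using that sym by blast
      then show ?thesis using 2 e(2) \<open>z \<noteq> y\<close> by auto
    next
      case 3
      then show ?thesis using c(2) that insert.hyps(2) by auto
    qed
  qed
  ultimately show ?case by blast
qed

section \<open>Counting parity vectors\<close>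

definition parity :: "('a \<Rightarrow> int) \<Rightarrow> nat \<Rightarrow> 'a set \<Rightarrow> ('a \<Rightarrow> int) \<Rightarrow> nat \<Rightarrow> int" where
  "parity a k S d = (\<lambda>i\<in>{..k}. \<Sum>w\<in>S. a w ^ i * d w)"

lemma parity_cong:
  "(\<And>w. w \<in> S \<Longrightarrow> d w = d' w) \<Longrightarrow> parity a k S d = parity a k S d'"
  by (simp add: parity_def cong: sum.cong)

text \<open>Here \<open>d\<close> stands for the difference of two digit vectors that a client
  cannot tell apart: digits below \<open>q\<close> differ by at most \<open>q\<close>, and known
  digits, those outside \<open>U\<close>, do not differ.\<close>

definition parities :: "('a \<Rightarrow> int) \<Rightarrow> nat \<Rightarrow> 'a set \<Rightarrow> 'a set \<Rightarrow> nat \<Rightarrow> (nat \<Rightarrow> int) set" where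
  "parities a k S U q =
     parity a k S ` {d. (\<forall>w\<in>S. \<bar>d w\<bar> \<le> int q) \<and> (\<forall>w\<in>S - U. d w = 0)}"

text \<open>The two arguments of \<open>min\<close> are two counts: by the free digit differences on
  \<open>S \<inter> U\<close>, or by the \<open>k + 1\<close> coordinates of the parity vector, each
  of absolute value at most \<open>C * q\<close>.\<close>

lemma card_parities:
  assumes "finite S" "C \<ge> 1"
    and C: "\<And>i. i \<le> k \<Longrightarrow> (\<Sum>w\<in>S. \<bar>a w\<bar> ^ i) \<le> int C"
  shows "finite (parities a k S U q)"
    and "card (parities a k S U q) \<le> (2 * C * q + 1) ^ min (card (S \<inter> U)) (k + 1)"
proof -
  let ?I = "{- int q..int q}"
  let ?J = "{- int (C * q)..int (C * q)}"
  let ?E = "\<lambda>d w. if w \<in> U then d w else 0"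
  have sub1: "parities a k S U q \<subseteq> (\<lambda>d. parity a k S (?E d)) ` (S \<inter> U \<rightarrow>\<^sub>E ?I)"
  proof
    fix y assume "y \<in> parities a k S U q"
    then obtain d where d: "y = parity a k S d" "\<forall>w\<in>S. \<bar>d w\<bar> \<le> int q" "\<forall>w\<in>S - U. d w = 0"
      unfolding parities_def by blast
    have "y = parity a k S (?E (restrict d (S \<inter> U)))"
      unfolding d(1) using d(3) by (intro parity_cong) auto
    moreover have "restrict d (S \<inter> U) \<in> S \<inter> U \<rightarrow>\<^sub>E ?I"
      using d(2) by (auto simp: abs_le_iff)
    ultimately show "y \<in> (\<lambda>d. parity a k S (?E d)) ` (S \<inter> U \<rightarrow>\<^sub>E ?I)" by blast
  qed
  have fin1: "finite (S \<inter> U \<rightarrow>\<^sub>E ?I)" using assms(1) by (intro finite_PiE) auto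
  show fin: "finite (parities a k S U q)"
    using sub1 fin1 by (meson finite_imageI finite_subset)
  have "card (parities a k S U q) \<le> card (S \<inter> U \<rightarrow>\<^sub>E ?I)"
    using sub1 fin1 by (rule surj_card_le[rotated])
  also have "\<dots> = (2 * q + 1) ^ card (S \<inter> U)"
    using assms(1) by (simp add: card_PiE nat_add_distrib nat_mult_distrib)
  also have "\<dots> \<le> (2 * C * q + 1) ^ card (S \<inter> U)"
    using assms(2) by (intro power_mono) auto
  finally have 1: "card (parities a k S U q) \<le> (2 * C * q + 1) ^ card (S \<inter> U)" .
  have sub2: "parities a k S U q \<subseteq> {..k} \<rightarrow>\<^sub>E ?J"
  proof
    fix y assume "y \<in> parities a k S U q"
    then obtain d where d: "y = parity a k S d" "\<And>w. w \<in> S \<Longrightarrow> \<bar>d w\<bar> \<le> int q"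
      unfolding parities_def by blast
    have "\<bar>\<Sum>w\<in>S. a w ^ i * d w\<bar> \<le> int (C * q)" if "i \<le> k" for i
    proof -
      have "\<bar>\<Sum>w\<in>S. a w ^ i * d w\<bar> \<le> (\<Sum>w\<in>S. \<bar>a w ^ i * d w\<bar>)" by (rule sum_abs)
      also have "\<dots> \<le> (\<Sum>w\<in>S. \<bar>a w\<bar> ^ i * int q)"
        using d(2) by (intro sum_mono) (auto simp: abs_mult power_abs intro!: mult_left_mono)
      also have "\<dots> = (\<Sum>w\<in>S. \<bar>a w\<bar> ^ i) * int q" by (simp add: sum_distrib_right)
      also have "\<dots> \<le> int C * int q" using C[OF that] by (intro mult_right_mono) auto
      finally show ?thesis by simp
    qed
    then show "y \<in> {..k} \<rightarrow>\<^sub>E ?J"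
      unfolding d(1) parity_def by (intro restrict_PiE_iff[THEN iffD2] ballI)
        (simp only: abs_le_iff atLeastAtMost_iff atMost_iff minus_le_iff)
  qed
  have "card (parities a k S U q) \<le> card ({..k} \<rightarrow>\<^sub>E ?J)"
    using sub2 by (intro card_mono finite_PiE) auto
  also have "\<dots> = (2 * C * q + 1) ^ (k + 1)"
  proof -
    have "card ?J = 2 * C * q + 1" by (simp add: nat_add_distrib nat_mult_distrib)
    then show ?thesis by (simp add: card_PiE)
  qed
  finally show "card (parities a k S U q) \<le> (2 * C * q + 1) ^ min (card (S \<inter> U)) (k + 1)"
    using 1 by (simp add: min_def)
qed

section \<open>From encoders to the broadcast rate\<close>

text \<open>The decoder picks any message vector consistent with what the client sees;
  \<open>dec\<close> makes the choice irrelevant at \<open>v\<close>. Inconsistent inputs decode to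
  0, a letter because \<open>Q > 0\<close>.\<close>

lemma index_code_of_encoder:
  assumes "finite M" "f \<in> (verts G \<rightarrow>\<^sub>E {..<Q}) \<rightarrow> M" "Q > 0"
    and dec: "\<And>p p' v. \<lbrakk>p \<in> verts G \<rightarrow>\<^sub>E {..<Q}; p' \<in> verts G \<rightarrow>\<^sub>E {..<Q}; v \<in> verts G;
      \<And>w. w \<in> out_nbrs v G \<Longrightarrow> p w = p' w; f p = f p'\<rbrakk> \<Longrightarrow> p v = p' v"
  shows "\<exists>g. index_code G Q M f g"
proof -
  let ?P = "verts G \<rightarrow>\<^sub>E {..<Q}"
  let ?ok = "\<lambda>v m x p. p \<in> ?P \<and> f p = m \<and> restrict p (out_nbrs v G) = x"
  define g where "g v = (\<lambda>(m, x). if \<exists>p. ?ok v m x p then (SOME p. ?ok v m x p) v else 0)" for v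
  have range: "g v y < Q" if "v \<in> verts G" for v y
  proof (cases y)
    case (Pair m x)
    show ?thesis
    proof (cases "\<exists>p. ?ok v m x p")
      case True
      from someI_ex[OF this] show ?thesis
        using True that unfolding g_def Pair by auto
    qed (use assms(3) in \<open>auto simp: g_def Pair\<close>)
  qed
  have "g v (f p, restrict p (out_nbrs v G)) = p v" if "p \<in> ?P" "v \<in> verts G" for p v
  proof -
    let ?x = "restrict p (out_nbrs v G)"
    define p' where "p' = (SOME p'. ?ok v (f p) ?x p')"
    have ex: "\<exists>p'. ?ok v (f p) ?x p'" using that by blast
    then have ok: "?ok v (f p) ?x p'" unfolding p'_def by (rule someI_ex)
    have agree: "p' w = p w" if "w \<in> out_nbrs v G" for w
      using ok that by (metis restrict_apply')
    have "p' v = p v"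
      by (rule dec) (use ok that agree in auto)
    then show ?thesis using ex by (simp add: g_def p'_def)
  qed
  then show ?thesis
    using assms(1,2) range unfolding index_code_def by blast
qed

lemma Ind_le:
  assumes "digraph G" "index_code G Q M f g" "Q \<ge> 2"
  shows "Ind G \<le> log (real Q) (real (card M))"
proof -
  \<comment> \<open>The outer infimum is a lower bound only if its family is bounded below.\<close>
  have nonneg: "0 \<le> Ind_alphabet q G" if "q \<ge> 2" for q
    unfolding Ind_alphabet_def
  proof (rule cInf_greatest)
    show "{log (real q) (real (card M)) |M f g. index_code G q M f g} \<noteq> {}"
      using index_code_exists[OF assms(1), of q] that by auto
  qed (use that index_code_rate_nonneg in blast)
  have "Ind G \<le> Ind_alphabet Q G"
    unfolding Ind_def using nonneg assms(3)
    by (intro cINF_lower bdd_belowI[of _ 0]) auto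
  also have "\<dots> \<le> log (real Q) (real (card M))"
    unfolding Ind_alphabet_def using assms index_code_rate_nonneg
    by (intro cInf_lower bdd_belowI[of _ 0]) blast+
  finally show ?thesis .
qed

section \<open>Bounds from the clique defect\<close>

text \<open>The set on the left contains \<open>v\<close> itself, which accounts for the
  \<open>+ 1\<close> over the term of \<open>v\<close> in the maximum defining the defect.\<close>

lemma card_unknown_le:
  assumes "digraph G" "S \<subseteq> verts G" "v \<in> S"
  shows "card (S - out_nbrs v G) \<le> clique_defect G S + 1"
proof -
  interpret digraph G by fact
  have fin: "finite S" using assms(2) finite_verts by (rule finite_subset)
  have "card S - 1 - card (out_nbrs v G \<inter> S) \<le> clique_defect G S"
    using assms(3) fin
    by (subst clique_defect_eq_Max[OF assms(1) _ assms(2)]) auto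
  moreover have "card (S - out_nbrs v G) = card S - card (out_nbrs v G \<inter> S)"
    using fin by (metis Int_commute card_Diff_subset_Int finite_Int)
  ultimately show ?thesis by linarith
qed

lemma clique_defect_le:
  assumes "digraph G" "S \<subseteq> verts G"
  shows "clique_defect G S \<le> card (verts G)"
proof (cases "S = {}")
  case False
  interpret digraph G by fact
  have fin: "finite S" using assms(2) finite_verts by (rule finite_subset)
  have "card S \<le> card (verts G)" using assms(2) by (intro card_mono) auto
  then show ?thesis
    using fin False by (subst clique_defect_eq_Max[OF assms(1) False assms(2)]) auto
qed (simp add: clique_defect_def)

section \<open>The code for prescribed slot numbers\<close>

text \<open>The factors other than \<open>q\<close> in the bound on \<open>card M\<close> depend
  only on \<open>n\<close>, so they become negligible in the rate for large
  \<open>q\<close>.\<close>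

lemma index_code_from_slots:
  fixes G :: "('a, 'b) pre_digraph" and m :: "'a set \<Rightarrow> nat"
  assumes "digraph G" "q \<ge> 1"
    and slots: "\<And>v. v \<in> verts G \<Longrightarrow> N \<le> (\<Sum>S | S \<in> Pow (verts G) \<and> v \<in> S. m S)"
    and load: "\<And>v. v \<in> verts G \<Longrightarrow>
      (\<Sum>S\<in>Pow (verts G). m S * min (card (S - out_nbrs v G)) (clique_defect G S + 1)) \<le> T"
  defines "n \<equiv> card (verts G)"
  shows "\<exists>M f g. index_code G (q ^ N) M f g \<and> card M \<le> (n + 1) * ((2 * (n * n ^ n + 1) + 1) * q) ^ T"
proof -
  interpret digraph G by fact
  let ?V = "verts G"
  let ?P = "?V \<rightarrow>\<^sub>E {..<q ^ N}"
  let ?k = "clique_defect G"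
  let ?N = "\<lambda>v. out_nbrs v G"
  \<comment> \<open>Bounds sums of at most \<open>n\<close> powers with bases and exponents at most
    \<open>n\<close>; the \<open>+ 1\<close> keeps \<open>C\<close> positive when
    \<open>n = 0\<close>.\<close>
  define C where "C = n * n ^ n + 1"
  \<comment> \<open>Absorbs the summand 1 of \<open>2 * C * q + 1\<close>, using
    \<open>q \<ge> 1\<close>, to get a base proportional to \<open>q\<close>.\<close>
  define B where "B = (2 * C + 1) * q"
  obtain b where b: "bij_betw b ?V {0..<n}"
    using ex_bij_betw_finite_nat[OF finite_verts] unfolding n_def by blast
  define a where "a = (\<lambda>w. int (b w))"
  have inj_a: "inj_on a ?V"
    using b by (auto simp: a_def bij_betw_def inj_on_def)
  have a_le: "\<bar>a w\<bar> \<le> int n" if "w \<in> ?V" for w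
    using bij_betwE[OF b] that by (fastforce simp: a_def)
  have C: "(\<Sum>w\<in>S. \<bar>a w\<bar> ^ i) \<le> int C" if "S \<subseteq> ?V" "i \<le> ?k S" for S i
  proof -
    have "i \<le> n" using that clique_defect_le[OF assms(1)] unfolding n_def by (meson le_trans)
    have "\<bar>a w\<bar> ^ i \<le> int n ^ n" if w: "w \<in> S" for w
    proof -
      have "w \<in> ?V" using w \<open>S \<subseteq> ?V\<close> by blast
      then have "n \<noteq> 0" unfolding n_def by auto
      have "\<bar>a w\<bar> ^ i \<le> int n ^ i" using a_le[OF \<open>w \<in> ?V\<close>] by (intro power_mono) auto
      also have "\<dots> \<le> int n ^ n" using \<open>n \<noteq> 0\<close> \<open>i \<le> n\<close> by (intro power_increasing) auto
      finally show ?thesis .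
    qed
    then have "(\<Sum>w\<in>S. \<bar>a w\<bar> ^ i) \<le> int (card S) * int n ^ n"
      by (rule sum_bounded_above)
    also have "\<dots> \<le> int n * int n ^ n"
      using card_mono[OF finite_verts that(1)] unfolding n_def by (intro mult_right_mono) auto
    finally show ?thesis by (simp add: C_def)
  qed

  \<comment> \<open>A slot is a pair of a set \<open>S\<close> and an index below
    \<open>m S\<close>; \<open>v\<close> has a digit in each slot of each set containing it.\<close>
  define slots_of where "slots_of v = Sigma {S \<in> Pow ?V. v \<in> S} (\<lambda>S. {..<m S})" for v
  define J where "J = Sigma (Pow ?V) (\<lambda>S. {..<m S})"
  have fin_J: "finite J" unfolding J_def by auto
  have J_sub: "fst x \<subseteq> ?V" if "x \<in> J" for x using that by (auto simp: J_def)
  have slots_ofI: "x \<in> slots_of w" if "x \<in> J" "w \<in> fst x" for x w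
    using that by (auto simp: J_def slots_of_def)
  have "\<exists>h. h \<in> {..<q ^ N} \<rightarrow> (slots_of v \<rightarrow>\<^sub>E {..<q}) \<and> inj_on h {..<q ^ N}" if "v \<in> ?V" for v
  proof -
    have fin: "finite (slots_of v)" unfolding slots_of_def by auto
    have "q ^ N \<le> q ^ card (slots_of v)"
      using slots[OF that] assms(2) unfolding slots_of_def
      by (intro power_increasing) auto
    also have "\<dots> = card (slots_of v \<rightarrow>\<^sub>E {..<q})" using fin by (simp add: card_PiE)
    finally have "card {..<q ^ N} \<le> card (slots_of v \<rightarrow>\<^sub>E {..<q})" by simp
    then obtain h where "inj_on h {..<q ^ N}" "h ` {..<q ^ N} \<subseteq> slots_of v \<rightarrow>\<^sub>E {..<q}"
      using fin by (metis card_le_inj finite_PiE finite_lessThan)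
    then show ?thesis by blast
  qed
  then obtain e where
    e_mem: "\<And>v c. \<lbrakk>v \<in> ?V; c < q ^ N\<rbrakk> \<Longrightarrow> e v c \<in> slots_of v \<rightarrow>\<^sub>E {..<q}" and
    e_inj: "\<And>v. v \<in> ?V \<Longrightarrow> inj_on (e v) {..<q ^ N}"
    by (metis Pi_iff lessThan_iff)

  define s where
    "s p = (\<lambda>x\<in>J. parity a (?k (fst x)) (fst x) (\<lambda>w. int (e w (p w) x)))" for p
  let ?Y = "s ` ?P"
  define agree where "agree v p p' \<longleftrightarrow> (\<forall>w\<in>?N v. p w = p' w)" for v and p p' :: "'a \<Rightarrow> nat"
  \<comment> \<open>Conflict: some client has the same side information for messages behind
    \<open>y\<close> and \<open>y'\<close>, so unequal \<open>y\<close> and \<open>y'\<close> need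
    different colours.\<close>
  define R where
    "R y y' \<longleftrightarrow> (\<exists>v\<in>?V. \<exists>p\<in>?P. \<exists>p'\<in>?P. y = s p \<and> y' = s p' \<and> agree v p p')" for y y'
  define D where "D v = (\<Pi>\<^sub>E x\<in>J. parities a (?k (fst x)) (fst x) (?V - ?N v) q)" for v
  define diff where
    "diff y y' = (\<lambda>x\<in>J. \<lambda>i\<in>{..?k (fst x)}. y x i - y' x i)" for y y' :: "'a set \<times> nat \<Rightarrow> nat \<Rightarrow> int"

  have fin_D: "finite (D v)" for v
    unfolding D_def using fin_J J_sub C finite_verts
    by (intro finite_PiE card_parities(1)[of _ C]) (auto simp: C_def intro: finite_subset[OF _ finite_verts])
  have card_D: "card (D v) \<le> B ^ T" if v: "v \<in> ?V" for v
  proof -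
    let ?c = "\<lambda>S. min (card (S - ?N v)) (?k S + 1)"
    have "card (parities a (?k (fst x)) (fst x) (?V - ?N v) q) \<le> B ^ ?c (fst x)" if x: "x \<in> J" for x
    proof -
      have fin: "finite (fst x)" using J_sub[OF x] finite_verts by (rule finite_subset)
      have "fst x \<inter> (?V - ?N v) = fst x - ?N v" using J_sub[OF x] by blast
      then have "card (parities a (?k (fst x)) (fst x) (?V - ?N v) q) \<le> (2 * C * q + 1) ^ ?c (fst x)"
        using card_parities(2)[OF fin _ C[OF J_sub[OF x]], of "?k (fst x)" "?V - ?N v" q]
        by (simp add: C_def)
      also have "\<dots> \<le> B ^ ?c (fst x)"
        using assms(2) by (intro power_mono) (auto simp: B_def algebra_simps)
      finally show ?thesis .
    qed
    then have "card (D v) \<le> (\<Prod>x\<in>J. B ^ ?c (fst x))"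
      unfolding D_def using fin_J by (simp add: card_PiE prod_mono)
    also have "\<dots> = B ^ (\<Sum>x\<in>J. ?c (fst x))" by (simp add: power_sum)
    also have "(\<Sum>x\<in>J. ?c (fst x)) = (\<Sum>S\<in>Pow ?V. m S * ?c S)"
    proof -
      have "(\<Sum>x\<in>J. ?c (fst x)) = (\<Sum>(S, j)\<in>J. ?c S)" by (simp add: case_prod_unfold)
      also have "\<dots> = (\<Sum>S\<in>Pow ?V. \<Sum>j<m S. ?c S)" unfolding J_def by (subst sum.Sigma) auto
      finally show ?thesis by simp
    qed
    also have "B ^ \<dots> \<le> B ^ T"
      using load[OF v] assms(2) by (intro power_increasing) (auto simp: B_def)
    finally show ?thesis .
  qed

  \<comment> \<open>Parities are linear, so the difference is the parity vector of the digit
    differences, which vanish at the out-neighbours of \<open>v\<close>.\<close>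
  have diff_mem: "diff (s p) (s p') \<in> D v"
    if v: "v \<in> ?V" and p: "p \<in> ?P" and p': "p' \<in> ?P" and ag: "agree v p p'" for v p p'
  proof -
    have "(\<lambda>i\<in>{..?k (fst x)}. s p x i - s p' x i) \<in> parities a (?k (fst x)) (fst x) (?V - ?N v) q"
      if x: "x \<in> J" for x
    proof -
      let ?d = "\<lambda>w. int (e w (p w) x) - int (e w (p' w) x)"
      have "(\<lambda>i\<in>{..?k (fst x)}. s p x i - s p' x i) = parity a (?k (fst x)) (fst x) ?d"
        using x by (intro ext)
          (simp add: s_def parity_def right_diff_distrib sum_subtractf restrict_def)
      moreover have "\<bar>?d w\<bar> \<le> int q" if w: "w \<in> fst x" for w
      proof -
        have wV: "w \<in> ?V" using w J_sub[OF x] by blast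
        then have "p w < q ^ N" "p' w < q ^ N" using p p' by auto
        then have "e w (p w) x < q" "e w (p' w) x < q"
          using e_mem[OF wV] slots_ofI[OF x w] by (auto dest!: PiE_mem)
        then show ?thesis by linarith
      qed
      moreover have "?d w = 0" if "w \<in> fst x - (?V - ?N v)" for w
        using that J_sub[OF x] ag by (auto simp: agree_def)
      ultimately show ?thesis unfolding parities_def by blast
    qed
    then show ?thesis unfolding D_def diff_def by auto
  qed

  have fin_P: "finite ?P" by (intro finite_PiE) auto
  have fin_Y: "finite ?Y" using fin_P by blast
  have R_sym: "R y y'" if "R y' y" for y y'
    using that unfolding R_def agree_def by metis
  \<comment> \<open>For fixed \<open>y\<close>, a neighbour \<open>y'\<close> is determined by its
    difference from \<open>y\<close>, which lies in some \<open>D v\<close>.\<close>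
  have R_degree: "card {y' \<in> ?Y. y' \<noteq> y \<and> R y y'} \<le> n * B ^ T" if y: "y \<in> ?Y" for y
  proof -
    let ?Z = "{y' \<in> ?Y. y' \<noteq> y \<and> R y y'}"
    have "inj_on (diff y) ?Y"
    proof (rule inj_onI)
      fix y1 y2 assume y12: "y1 \<in> ?Y" "y2 \<in> ?Y" and eq: "diff y y1 = diff y y2"
      have val: "y1 x i = y2 x i" if "x \<in> J" "i \<le> ?k (fst x)" for x i
        using fun_cong[OF fun_cong[OF eq, of x], of i] that by (simp add: diff_def)
      show "y1 = y2"
      \<comment> \<open>Positions ignored by \<open>diff\<close> hold the same default value in all
        parity vectors.\<close>
      proof (intro ext)
        fix x i
        show "y1 x i = y2 x i"
          using val[of x i] y12 by (cases "x \<in> J"; cases "i \<le> ?k (fst x)") (auto simp: s_def parity_def)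
      qed
    qed
    then have "card ?Z = card (diff y ` ?Z)"
      by (intro card_image[symmetric]) (auto intro: inj_on_subset)
    also have "\<dots> \<le> card (\<Union>v\<in>?V. D v)"
      using fin_D diff_mem unfolding R_def by (intro card_mono) auto
    also have "\<dots> \<le> (\<Sum>v\<in>?V. card (D v))" by (intro card_UN_le) auto
    also have "\<dots> \<le> n * B ^ T"
      using sum_bounded_above[of ?V "\<lambda>v. card (D v)" "B ^ T"] card_D unfolding n_def by simp
    finally show ?thesis .
  qed
  obtain c where c: "c \<in> ?Y \<rightarrow> {..n * B ^ T}"
    and proper: "\<And>y y'. \<lbrakk>y \<in> ?Y; y' \<in> ?Y; y' \<noteq> y; R y y'\<rbrakk> \<Longrightarrow> c y \<noteq> c y'"
    using greedy_colouring[of ?Y R, OF fin_Y R_sym R_degree] by metis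

  \<comment> \<open>The transmitted symbol is the colour of the parity vector.\<close>
  have "\<exists>g. index_code G (q ^ N) {..n * B ^ T} (c \<circ> s) g"
  proof (rule index_code_of_encoder)
    show "c \<circ> s \<in> ?P \<rightarrow> {..n * B ^ T}" using c by auto
    show "0 < q ^ N" using assms(2) by simp
    fix p p' v
    assume p: "p \<in> ?P" and p': "p' \<in> ?P" and v: "v \<in> ?V"
      and ag: "\<And>w. w \<in> ?N v \<Longrightarrow> p w = p' w" and "(c \<circ> s) p = (c \<circ> s) p'"
    then have col: "c (s p) = c (s p')" by simp
    have "R (s p) (s p')" using p p' v ag unfolding R_def agree_def by blast
    \<comment> \<open>Conflicting vectors of equal colour must coincide, so the client effectively
      learns all parities.\<close>
    then have eq: "s p = s p'"
      using proper[OF imageI[OF p] imageI[OF p']] col by (metis (no_types))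
    show "p v = p' v"
    proof (rule ccontr)
      assume "p v \<noteq> p' v"
      have pv: "p v < q ^ N" "p' v < q ^ N" using p p' v by auto
      then have "e v (p v) \<noteq> e v (p' v)"
        using e_inj[OF v] \<open>p v \<noteq> p' v\<close> by (auto dest: inj_onD)
      then obtain x where x: "x \<in> slots_of v" "e v (p v) x \<noteq> e v (p' v) x"
        using PiE_ext[OF e_mem[OF v pv(1)] e_mem[OF v pv(2)]] by blast
      let ?S = "fst x"
      have xJ: "x \<in> J" and S: "?S \<subseteq> ?V" "v \<in> ?S"
        using x(1) by (auto simp: slots_of_def J_def)
      have finS: "finite ?S" using S(1) finite_verts by (rule finite_subset)
      let ?d = "\<lambda>w. int (e w (p w) x) - int (e w (p' w) x)"
      \<comment> \<open>Known digits cancel, leaving a homogeneous Vandermonde system in the unknown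
        ones.\<close>
      have zero: "(\<Sum>w\<in>?S - ?N v. a w ^ i * ?d w) = 0" if "i \<le> ?k ?S" for i
      proof -
        have "(\<Sum>w\<in>?S - ?N v. a w ^ i * ?d w) = (\<Sum>w\<in>?S. a w ^ i * ?d w)"
          using finS ag by (intro sum.mono_neutral_left) auto
        also have "\<dots> = s p x i - s p' x i"
          using that xJ by (simp add: s_def parity_def right_diff_distrib sum_subtractf)
        finally show ?thesis using eq by simp
      qed
      have "v \<notin> ?N v" by (auto simp: out_nbrs_def dest: adj_not_same)
      have "?d v = 0"
      proof (rule vandermonde_kernel_trivial[where U = "?S - ?N v" and a = a and d = ?d])
        show "card (?S - ?N v) \<le> ?k ?S + 1"
          by (rule card_unknown_le[OF assms(1) S])
        show "inj_on a (?S - ?N v)" using inj_a S(1) by (auto intro: inj_on_subset)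
      qed (use finS zero S \<open>v \<notin> ?N v\<close> in auto)
      then show False using x(2) by simp
    qed
  qed simp
  moreover have "card {..n * B ^ T} \<le> (n + 1) * B ^ T"
  proof -
    have "B ^ T \<ge> 1" using assms(2) by (simp add: B_def)
    then show ?thesis by simp
  qed
  ultimately show ?thesis unfolding B_def C_def by blast
qed

section \<open>Large alphabets and rounding of the linear program\<close>

text \<open>With \<open>N\<close> and \<open>T\<close> fixed, the constant factors add
  \<open>c / (N ln q)\<close> to the rate, which vanishes as \<open>q\<close> grows.\<close>

lemma Ind_le_load_ratio:
  fixes G :: "('a, 'b) pre_digraph" and m :: "'a set \<Rightarrow> nat"
  assumes "digraph G" "N > 0"
    and slots: "\<And>v. v \<in> verts G \<Longrightarrow> N \<le> (\<Sum>S | S \<in> Pow (verts G) \<and> v \<in> S. m S)"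
    and load: "\<And>v. v \<in> verts G \<Longrightarrow>
      (\<Sum>S\<in>Pow (verts G). m S * min (card (S - out_nbrs v G)) (clique_defect G S + 1)) \<le> T"
  shows "Ind G \<le> real T / real N"
proof -
  define n where "n = card (verts G)"
  define K where "K = 2 * (n * n ^ n + 1) + 1"
  define c where "c = ln (real (n + 1)) + real T * ln (real K)"
  have bound: "Ind G \<le> c / (real N * ln (real q)) + real T / real N" if q: "q \<ge> 2" for q
  proof -
    obtain M f g where code: "index_code G (q ^ N) M f g"
      and card_M: "card M \<le> (n + 1) * (K * q) ^ T"
      using index_code_from_slots[OF assms(1) _ slots load, of q] q
      unfolding n_def K_def by auto
    have "q ^ 1 \<le> q ^ N" using q assms(2) by (intro power_increasing) auto
    then have qN: "q ^ N \<ge> 2" using q by simp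
    let ?X = "real ((n + 1) * (K * q) ^ T)"
    have "K > 0" by (simp add: K_def)
    have X: "ln ?X = c + real T * ln (real q)"
    proof -
      have "ln ?X = ln (real (n + 1)) + ln ((real K * real q) ^ T)"
        using q \<open>K > 0\<close> unfolding of_nat_mult of_nat_power by (subst ln_mult) auto
      also have "ln ((real K * real q) ^ T) = real T * (ln (real K) + ln (real q))"
        using q \<open>K > 0\<close> by (simp add: ln_realpow ln_mult)
      finally show ?thesis by (simp add: c_def algebra_simps)
    qed
    have "(n + 1) * (K * q) ^ T > 0" using q \<open>K > 0\<close> by simp
    \<comment> \<open>This makes \<open>ln ?X\<close> nonnegative, covering
      \<open>card M = 0\<close>, where \<open>ln 0 = 0\<close> by convention.\<close>
    then have "?X \<ge> 1" by linarith
    then have "ln (real (card M)) \<le> ln ?X"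
      using card_M by (cases "card M = 0") (auto simp del: of_nat_mult of_nat_power)
    have "Ind G \<le> log (real (q ^ N)) (real (card M))"
      by (rule Ind_le[OF assms(1) code qN])
    also have "\<dots> = ln (real (card M)) / (real N * ln (real q))"
      using q by (simp add: log_def ln_realpow)
    also have "\<dots> \<le> ln ?X / (real N * ln (real q))"
      using q \<open>ln (real (card M)) \<le> ln ?X\<close> by (intro divide_right_mono) auto
    also have "\<dots> = c / (real N * ln (real q)) + real T / real N"
      unfolding X using q by (simp add: add_divide_distrib)
    finally show ?thesis .
  qed
  have "(\<lambda>q. c / (real N * ln (real q)) + real T / real N) \<longlonglongrightarrow> real T / real N"
    using assms(2) by real_asymp
  then show ?thesis using bound by (intro LIMSEQ_le_const) auto
qed

theorem theorem8:
  fixes G :: "('a, 'b) pre_digraph"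
  assumes "digraph G" and "verts G \<noteq> {}"
  shows "Ind G \<le> lp_optimum G"
proof -
  interpret digraph G by fact
  have "Ind G \<le> t" if feas: "lp_feasible G t \<rho>" for t \<rho>
  proof -
    let ?V = "verts G"
    define c where "c v S = min (card (S - out_nbrs v G)) (clique_defect G S + 1)" for v S
    have unknown: "S \<inter> ({v} \<union> out_nbrs v (complement G)) = S - out_nbrs v G"
      if "v \<in> ?V" "S \<in> Pow ?V" for v S
      using that unfolding out_nbrs_complement[OF assms(1) that(1)] by blast
    have load: "(\<Sum>S\<in>Pow ?V. real (c v S) * \<rho> S) \<le> t" if "v \<in> ?V" for v
    proof -
      have "(\<Sum>S\<in>Pow ?V. real (c v S) * \<rho> S) =
          (\<Sum>S\<in>Pow ?V.
            real (min (card (S \<inter> ({v} \<union> out_nbrs v (complement G)))) (clique_defect G S + 1)) * \<rho> S)"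
        unfolding c_def by (intro sum.cong refl) (simp only: unknown[OF that])
      also have "\<dots> \<le> t" using feas that unfolding lp_feasible_def by blast
      finally show ?thesis .
    qed
    have cover: "(\<Sum>S | S \<in> Pow ?V \<and> v \<in> S. \<rho> S) \<ge> 1" if "v \<in> ?V" for v
      using feas that unfolding lp_feasible_def by blast
    have nonneg: "\<rho> S \<ge> 0" if "S \<in> Pow ?V" for S
      using feas that unfolding lp_feasible_def by auto
    \<comment> \<open>Rounding adds at most one slot per set, raising the load of any client by at
      most \<open>A\<close>, independently of \<open>N\<close>.\<close>
    define A where "A = (\<Sum>v\<in>?V. \<Sum>S\<in>Pow ?V. c v S)"
    have c_le_A: "(\<Sum>S\<in>Pow ?V. c v S) \<le> A" if "v \<in> ?V" for v
      unfolding A_def using that by (intro member_le_sum) auto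
    \<comment> \<open>Nonnegativity of \<open>t\<close> ensures that \<open>nat\<close> in the later
      \<open>T\<close> does not round a negative value up.\<close>
    obtain u where "u \<in> ?V" using assms(2) by blast
    have "0 \<le> (\<Sum>S\<in>Pow ?V. real (c u S) * \<rho> S)" using nonneg by (intro sum_nonneg) auto
    also have "\<dots> \<le> t" by (rule load) fact
    finally have "t \<ge> 0" .
    have bound: "Ind G \<le> t + real A / real N" if "N > 0" for N
    proof -
      define m where "m S = nat \<lceil>real N * \<rho> S\<rceil>" for S
      define T where "T = nat \<lfloor>real N * t + real A\<rfloor>"
      have m_ge: "real N * \<rho> S \<le> real (m S)" for S
        unfolding m_def by (rule real_nat_ceiling_ge)
      have m_le: "real (m S) \<le> real N * \<rho> S + 1" if "S \<in> Pow ?V" for S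
        unfolding m_def using nonneg[OF that] ceiling_correct[of "real N * \<rho> S"] by simp
      have "Ind G \<le> real T / real N"
      proof (rule Ind_le_load_ratio[OF assms(1) that])
        fix v assume v: "v \<in> ?V"
        have "real N \<le> real N * (\<Sum>S | S \<in> Pow ?V \<and> v \<in> S. \<rho> S)"
          using mult_left_mono[OF cover[OF v], of "real N"] by simp
        also have "\<dots> \<le> (\<Sum>S | S \<in> Pow ?V \<and> v \<in> S. real (m S))"
          unfolding sum_distrib_left by (intro sum_mono m_ge)
        finally show "N \<le> (\<Sum>S | S \<in> Pow ?V \<and> v \<in> S. m S)"
          by (simp flip: of_nat_sum)
        have "real (\<Sum>S\<in>Pow ?V. m S * c v S) \<le> (\<Sum>S\<in>Pow ?V. (real N * \<rho> S + 1) * real (c v S))"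
          unfolding of_nat_sum of_nat_mult using m_le by (intro sum_mono mult_right_mono) auto
        also have "\<dots> = real N * (\<Sum>S\<in>Pow ?V. real (c v S) * \<rho> S) + real (\<Sum>S\<in>Pow ?V. c v S)"
          by (simp add: sum_distrib_left sum.distrib algebra_simps)
        also have "\<dots> \<le> real N * t + real A"
          using load[OF v] c_le_A[OF v] by (intro add_mono mult_left_mono of_nat_mono) auto
        finally have "(\<Sum>S\<in>Pow ?V. m S * c v S) \<le> T"
          unfolding T_def by (rule le_nat_floor)
        then show "(\<Sum>S\<in>Pow ?V. m S * min (card (S - out_nbrs v G)) (clique_defect G S + 1)) \<le> T"
          unfolding c_def .
      qed
      also have "\<dots> \<le> (real N * t + real A) / real N"
        unfolding T_def using \<open>t \<ge> 0\<close> by (intro divide_right_mono of_nat_floor) auto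
      also have "\<dots> = t + real A / real N" using that by (simp add: add_divide_distrib)
      finally show ?thesis .
    qed
    \<comment> \<open>The rounding loss disappears as the number of slots grows.\<close>
    have "(\<lambda>N. t + real A / real N) \<longlonglongrightarrow> t" by real_asymp
    then show ?thesis using bound by (intro LIMSEQ_le_const) (auto intro!: exI[of _ 1])
  qed
  then show ?thesis
    unfolding lp_optimum_def by (intro cInf_greatest lp_values_nonempty assms(1)) auto
qed

end
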